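(* Let $d\in\mathbb N$, let $\rho\colon\mathbb R\to\mathbb R$ be a function, and for $n\in\mathbb N$ let $\Theta_n$ be the set of neural networks with input dimension $d$, output dimension $1$, depth $\lceil\log_2(d+1)\rceil+1$ and width at most $n$. Let $(X,\|\cdot\|_X)$ be a Banach space of functions on a domain $\Omega\subset\mathbb R^d$ such that $A_n:=R_\rho(\Theta_n)\subset X$ for all $n$. Let $(Y,\|\cdot\|_Y)$ and $(B,\|\cdot\|_B)$ be Banach spaces, $T\colon X\to Y$, $\gamma\colon X\to B$ and $E\colon X\to\mathbb R$ maps, $|\cdot|$ a further norm on $X$ (not necessarily complete), and $f\in X'$. Put $X_0=\ker(\gamma)$ and define $F_n,F\colon X\to(-\infty,\infty]$ by $$F_n(x)=\begin{cases}E(x)+n\|\gamma(x)\|_B^2-f(x), & x\in A_n,\\ \infty, & x\notin A_n,\end{cases}\qquad F(x)=\begin{cases}E(x)-f(x), & x\in X_0,\\ \infty, & x\notin X_0.\end{cases}$$ Assume: (H1) $\bigcup_{n\in\mathbb N}A_n\cap X_0$ is dense in $X_0$ with respect to $\|\cdot\|_X$. (H2) $X$ is reflexive, $T\colon(X,\|\cdot\|_X)\to(Y,\|\cdot\|_Y)$ is linear and continuous, and $\|x\|_X=|x|+\|Tx\|_Y$ for all $x\in X$. (H3) The identity $(X,\|\cdot\|_X)\to(X,|\cdot|)$ maps weakly convergent sequences to strongly convergent ones. (H4) $\gamma\colon (X,\|\cdot\|_X)\to B$ is linear and continuous, and for every $r\in\mathbb R$ the set $\{x\in X:\|\gamma(x)\|_B^2-f(x)\le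 r\}\cap\ker(T)$ is bounded in $X$ by a constant $C=C(r)<\infty$. (H5) $E$ is bounded from below, weakly lower semi-continuous (with respect to the weak topology of $(X,\|\cdot\|_X)$) and $\|\cdot\|_X$-continuous, and there are $p>1$ and constants $c_1>0$, $c_2\in\mathbb R$ with $|E(x)|\ge c_1\|Tx\|_Y^p-c_2$ for all $x\in X$; furthermore $E$ has a unique minimiser on $X_0$. Then $(F_n)_{n\in\mathbb N}$ $\Gamma$-converges to $F$ in the weak topology of $X$, and every sequence of quasi-minimisers of $(F_n)_{n\in\mathbb N}$ converges weakly in $X$ to the unique minimiser of $F$.
   Context: A neural network of depth $L$ with input dimension $d$ and output dimension $m$ is a tuple $\theta=((A_1,b_1),\dots,(A_L,b_L))$ with $A_l\in\mathbb R^{N_l\times N_{l-1}}$, $b_l\in\mathbb R^{N_l}$, $N_0=d$, $N_L=m$. Its width is $\max_{l=0,\dots,L}N_l$. With $T_l(x)=A_lx+b_l$, its realisation with respect to $\rho$ is $R_\rho(\theta)\colon\mathbb R^d\to\mathbb R^m$, $x\mapsto T_L(\rho(T_{L-1}(\rho(\cdots\rho(T_1(x))))))$, with $\rho$ applied componentwise. Realisations are regarded as elements of $X$ via restriction to $\Omega$ (elements of $X$ may be a.e.-equivalence classes of functions). $X'$ is the space of continuous linear functionals on $(X,\|\cdot\|_X)$. $\Gamma$-convergence of $F_n$ to $F$ in the weak topology of the reflexive space $X$ means: (1) for every $x\in X$ and every sequence $x_n\rightharpoonup x$ one has $F(x)\le\liminf_{n\to\infty}F_n(x_n)$; (2) for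 every $x\in X$ there is a sequence $x_n\rightharpoonup x$ with $F(x)=\lim_{n\to\infty}F_n(x_n)$. A sequence $(x_n)$ in $X$ is a sequence of quasi-minimisers of $(F_n)$ if $F_n(x_n)\le\inf_X F_n+\delta_n$ for all $n$, for some sequence $\delta_n\to0$.
   Formalization: Uniqueness of the minimiser of F does not follow from (H5), which concerns E only; the formal theorem proves that F has a minimiser and that quasi-minimisers converge weakly to it whenever that minimiser of F is unique. *)

theory Defs
  imports "HOL-Analysis.Analysis" "Jordan_Normal_Form.Matrix"
begin

text \<open>A network is the list of its layers \<open>(A\<^sub>1, b\<^sub>1), \<dots>, (A\<^sub>L, b\<^sub>L)\<close>, stored from
  index \<open>0\<close>. Matrices and vectors are those of the matrix library, since the layer sizes vary
  inside the statement.\<close>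

type_synonym network = "(real mat \<times> real vec) list"

definition has_layer_sizes :: "network \<Rightarrow> (nat \<Rightarrow> nat) \<Rightarrow> bool" where
  "has_layer_sizes \<theta> N \<longleftrightarrow>
     (\<forall>l\<le>length \<theta>. 1 \<le> N l) \<and>
     (\<forall>l<length \<theta>. fst (\<theta> ! l) \<in> carrier_mat (N (Suc l)) (N l) \<and>
                      snd (\<theta> ! l) \<in> carrier_vec (N (Suc l)))"

definition networks :: "nat \<Rightarrow> nat \<Rightarrow> nat \<Rightarrow> nat \<Rightarrow> network set" where
  "networks d m L n =
     {\<theta>. length \<theta> = L \<and>
          (\<exists>N. has_layer_sizes \<theta> N \<and> N 0 = d \<and> N L = m \<and> Max (N ` {0..L}) \<le> n)}"

fun net_eval :: "(real \<Rightarrow> real) \<Rightarrow> network \<Rightarrow> real vec \<Rightarrow> real vec" where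
  "net_eval \<rho> [] x = x"
| "net_eval \<rho> [(A, b)] x = A *\<^sub>v x + b"
| "net_eval \<rho> ((A, b) # \<theta>) x = net_eval \<rho> \<theta> (map_vec \<rho> (A *\<^sub>v x + b))"

text \<open>The coordinates of \<open>\<real>\<^sup>d\<close> are listed in a fixed order. The set of realisations of
  \<open>networks d 1 L n\<close> does not depend on it, as the columns of the first matrix may be permuted.\<close>

definition coord_vec :: "real ^ 'd \<Rightarrow> real vec" where
  "coord_vec x = Matrix.vec CARD('d) (\<lambda>i. vec_nth x (from_nat_into UNIV i))"

definition realisation :: "(real \<Rightarrow> real) \<Rightarrow> network \<Rightarrow> real ^ 'd \<Rightarrow> real" where
  "realisation \<rho> \<theta> x = vec_index (net_eval \<rho> \<theta> (coord_vec x)) 0"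

text \<open>A space of functions on \<open>\<Omega>\<close> is a vector space together with a map \<open>cls\<close> sending each
  element to the set of all its representatives. Functions are total, so in the first case a
  class consists of all functions with the same restriction to \<open>\<Omega>\<close>; in the second case it
  consists of all functions that agree almost everywhere on \<open>\<Omega>\<close>.\<close>

definition restriction_class :: "(real ^ 'd) set \<Rightarrow> (real ^ 'd \<Rightarrow> real) \<Rightarrow> (real ^ 'd \<Rightarrow> real) set"
  where "restriction_class \<Omega> u = {v. \<forall>t\<in>\<Omega>. v t = u t}"

definition ae_class :: "(real ^ 'd) set \<Rightarrow> (real ^ 'd \<Rightarrow> real) \<Rightarrow> (real ^ 'd \<Rightarrow> real) set"
  where "ae_class \<Omega> u = {v. AE t in lebesgue_on \<Omega>. v t = u t}"

definition function_space ::
    "(real ^ 'd) set \<Rightarrow> ('x::real_vector \<Rightarrow> (real ^ 'd \<Rightarrow> real) set) \<Rightarrow> bool" where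
  "function_space \<Omega> cls \<longleftrightarrow>
     (range cls \<subseteq> range (restriction_class \<Omega>) \<or> range cls \<subseteq> range (ae_class \<Omega>)) \<and>
     inj cls \<and>
     (\<forall>x y. \<forall>u\<in>cls x. \<forall>v\<in>cls y. (\<lambda>t. u t + v t) \<in> cls (x + y)) \<and>
     (\<forall>c x. \<forall>u\<in>cls x. (\<lambda>t. c * u t) \<in> cls (c *\<^sub>R x))"

definition net_functions :: "(real \<Rightarrow> real) \<Rightarrow> nat \<Rightarrow> (real ^ 'd \<Rightarrow> real) set" where
  "net_functions \<rho> n =
     realisation \<rho> ` networks CARD('d) 1 (nat \<lceil>log 2 (real CARD('d) + 1)\<rceil> + 1) n"

definition net_elements ::
    "('x \<Rightarrow> (real ^ 'd \<Rightarrow> real) set) \<Rightarrow> (real \<Rightarrow> real) \<Rightarrow> nat \<Rightarrow> 'x set" where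
  "net_elements cls \<rho> n = {x. \<exists>u\<in>net_functions \<rho> n. u \<in> cls x}"

definition reflexive_space :: "'x::real_normed_vector itself \<Rightarrow> bool" where
  "reflexive_space _ \<longleftrightarrow>
     (\<forall>\<Phi> :: ('x \<Rightarrow>\<^sub>L real) \<Rightarrow>\<^sub>L real. \<exists>x. \<forall>g. blinfun_apply \<Phi> g = blinfun_apply g x)"

definition weak_topology :: "'x::real_normed_vector topology" where
  "weak_topology =
     topology_generated_by {blinfun_apply g -` U | (g :: 'x \<Rightarrow>\<^sub>L real) U. open U}"

definition weak_lim :: "(nat \<Rightarrow> 'x::real_normed_vector) \<Rightarrow> 'x \<Rightarrow> bool" where
  "weak_lim xs x \<longleftrightarrow> limitin weak_topology xs x sequentially"

definition weakly_lsc :: "('x::real_normed_vector \<Rightarrow> real) \<Rightarrow> bool" where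
  "weakly_lsc E \<longleftrightarrow> (\<forall>r. openin weak_topology {x. r < E x})"

definition is_norm :: "('x::real_vector \<Rightarrow> real) \<Rightarrow> bool" where
  "is_norm N \<longleftrightarrow>
     (\<forall>x. 0 \<le> N x) \<and> (\<forall>x. N x = 0 \<longleftrightarrow> x = 0) \<and>
     (\<forall>c x. N (c *\<^sub>R x) = \<bar>c\<bar> * N x) \<and> (\<forall>x y. N (x + y) \<le> N x + N y)"

definition weak_Gamma_converges ::
    "(nat \<Rightarrow> 'x::real_normed_vector \<Rightarrow> ereal) \<Rightarrow> ('x \<Rightarrow> ereal) \<Rightarrow> bool" where
  "weak_Gamma_converges Fn F \<longleftrightarrow>
     (\<forall>x xs. weak_lim xs x \<longrightarrow> F x \<le> liminf (\<lambda>n. Fn n (xs n))) \<and>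
     (\<forall>x. \<exists>xs. weak_lim xs x \<and> (\<lambda>n. Fn n (xs n)) \<longlonglongrightarrow> F x)"

text \<open>An index \<open>n\<close> with \<open>Fn n\<close> constantly \<open>\<infinity>\<close> imposes no condition on \<open>xs n\<close>; this occurs for the
  penalised energies below when \<open>n\<close> is so small that there are no networks of width \<open>n\<close>.\<close>

definition quasi_minimisers :: "(nat \<Rightarrow> 'x \<Rightarrow> ereal) \<Rightarrow> (nat \<Rightarrow> 'x) \<Rightarrow> bool" where
  "quasi_minimisers Fn xs \<longleftrightarrow>
     (\<exists>\<delta> :: nat \<Rightarrow> real. \<delta> \<longlonglongrightarrow> 0 \<and> (\<forall>n. Fn n (xs n) \<le> (INF x. Fn n x) + ereal (\<delta> n)))"

definition penalised_energy ::
    "(nat \<Rightarrow> 'x set) \<Rightarrow> ('x \<Rightarrow> real) \<Rightarrow> ('x \<Rightarrow> 'b::real_normed_vector) \<Rightarrow> ('x \<Rightarrow> real) \<Rightarrow>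
      nat \<Rightarrow> 'x \<Rightarrow> ereal" where
  "penalised_energy A E \<gamma> f n x =
     (if x \<in> A n then ereal (E x + real n * (norm (\<gamma> x))\<^sup>2 - f x) else \<infinity>)"

definition limit_energy ::
    "'x set \<Rightarrow> ('x \<Rightarrow> real) \<Rightarrow> ('x \<Rightarrow> real) \<Rightarrow> 'x \<Rightarrow> ereal" where
  "limit_energy X\<^sub>0 E f x = (if x \<in> X\<^sub>0 then ereal (E x - f x) else \<infinity>)"

end

theory Submission
  imports Defs "HOL-Library.Diagonal_Subsequence" "HOL-Real_Asymp.Real_Asymp"
begin

text \<open>The energies \<open>E + \<parallel>\<gamma>\<parallel>\<^sup>2 - f\<close> are coercive: along a violating sequence the normalised points
  have \<open>T\<close>- and \<open>\<gamma>\<close>-images tending to \<open>0\<close>, because \<open>f\<close> grows linearly while \<open>\<parallel>T x\<parallel>\<^sup>p\<close> with \<open>p > 1\<close>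
  and \<open>\<parallel>\<gamma> x\<parallel>\<^sup>2\<close> grow faster. A weakly convergent subsequence has its limit in \<open>ker T \<inter> ker \<gamma>\<close>, which
  is trivial since a line in it would lie, on the half where \<open>f \<ge> 0\<close>, in a bounded set; compactness
  of the identity into \<open>(X, \<bar>\<cdot>\<bar>)\<close> then makes the normalised points tend to \<open>0\<close> in norm, a contradiction.
  The lower bound of the \<open>\<Gamma>\<close>-limit holds with any penalty weights tending to infinity, so it
  applies to subsequences of quasi-minimisers, each of which has a weak cluster point; that point
  minimises \<open>F\<close>. Weak sequential compactness of bounded sets in a reflexive space is derived
  from the Hahn--Banach theorem for sublinear functionals.\<close>

section \<open>The Hahn--Banach theorem\<close>

definition sublinear :: "('a::real_vector \<Rightarrow> real) \<Rightarrow> bool" where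
  "sublinear p \<longleftrightarrow> (\<forall>x y. p (x + y) \<le> p x + p y) \<and> (\<forall>t\<ge>0. \<forall>x. p (t *\<^sub>R x) = t * p x)"

text \<open>The inequality for all positive factors, used for \<open>1/t\<close> at
  \<open>t *\<^sub>R x\<close>, is the reverse inequality for \<open>t\<close>.\<close>

lemma sublinearI:
  assumes "\<And>x y. p (x + y) \<le> p x + p y" "\<And>t x. 0 < t \<Longrightarrow> p (t *\<^sub>R x) \<le> t * p x" "p 0 = 0"
  shows "sublinear p"
proof -
  have "p (t *\<^sub>R x) = t * p x" if "0 \<le> t" for t x
  proof (cases "t = 0")
    case False
    with that have t: "0 < t" by simp
    have "p ((1/t) *\<^sub>R (t *\<^sub>R x)) \<le> (1/t) * p (t *\<^sub>R x)"
      using t by (intro assms(2)) simp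
    then have "t * p x \<le> p (t *\<^sub>R x)" using t by (simp add: field_simps)
    with assms(2)[OF t, of x] show ?thesis by simp
  qed (simp add: assms(3))
  with assms(1) show ?thesis by (auto simp: sublinear_def)
qed

lemma sublinear_add: "sublinear p \<Longrightarrow> p (x + y) \<le> p x + p y"
  by (simp add: sublinear_def)

lemma sublinear_scale: "sublinear p \<Longrightarrow> 0 \<le> t \<Longrightarrow> p (t *\<^sub>R x) = t * p x"
  by (simp add: sublinear_def)

lemma sublinear_zero: "sublinear p \<Longrightarrow> p 0 = 0"
  using sublinear_scale[of p 0 0] by simp

lemma sublinear_minus: "sublinear p \<Longrightarrow> - p (- x) \<le> p x"
  using sublinear_add[of p x "- x"] sublinear_zero[of p] by simp

text \<open>The witness is \<open>q x = inf\<^bsub>t \<ge> 0\<^esub> p (x + t v) - t p v\<close>. Applied to a minimal \<open>p\<close> it shows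
  that \<open>p\<close> is odd, hence linear.\<close>

lemma sublinear_tilt:
  fixes p :: "'a::real_vector \<Rightarrow> real"
  assumes p: "sublinear p"
  shows "\<exists>q. sublinear q \<and> q \<le> p \<and> q (- v) \<le> - p v"
proof -
  define S where "S x = (\<lambda>t. p (x + t *\<^sub>R v) - t * p v) ` {0..}" for x
  define q where "q x = Inf (S x)" for x
  have ne: "S x \<noteq> {}" for x by (auto simp: S_def)
  have lower: "- p (- x) \<le> s" if "s \<in> S x" for s x
  proof -
    obtain t where t: "0 \<le> t" "s = p (x + t *\<^sub>R v) - t * p v" using \<open>s \<in> S x\<close> by (auto simp: S_def)
    \<comment> \<open>The left side is \<open>p (t *\<^sub>R v) = t * p v\<close>, so the infimum
      defining \<open>q x\<close> is bounded below by \<open>- p (- x)\<close>.\<close>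
    have "p ((x + t *\<^sub>R v) + - x) \<le> p (x + t *\<^sub>R v) + p (- x)" by (rule sublinear_add[OF p])
    then show ?thesis using t sublinear_scale[OF p, of t v] by simp
  qed
  then have bdd: "bdd_below (S x)" for x by (rule bdd_belowI)
  have upper: "q x \<le> p (x + t *\<^sub>R v) - t * p v" if "0 \<le> t" for x t
    unfolding q_def by (rule cInf_lower[OF _ bdd]) (use that in \<open>auto simp: S_def\<close>)
  have q0: "q 0 = 0"
  proof (rule antisym)
    show "q 0 \<le> 0" using upper[of 0 0] sublinear_zero[OF p] by simp
    show "0 \<le> q 0" unfolding q_def
      using lower[of _ 0] sublinear_zero[OF p] by (intro cInf_greatest[OF ne]) auto
  qed
  have "sublinear q"
  proof (rule sublinearI)
    fix x y
    have "q (x + y) \<le> a + b" if "a \<in> S x" "b \<in> S y" for a b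
    proof -
      obtain s t where st: "0 \<le> s" "a = p (x + s *\<^sub>R v) - s * p v" "0 \<le> t" "b = p (y + t *\<^sub>R v) - t * p v"
        using \<open>a \<in> S x\<close> \<open>b \<in> S y\<close> by (auto simp: S_def)
      have "q (x + y) \<le> p ((x + s *\<^sub>R v) + (y + t *\<^sub>R v)) - (s + t) * p v"
        using upper[of "s + t" "x + y"] st by (simp add: algebra_simps)
      also have "\<dots> \<le> a + b" using sublinear_add[OF p, of "x + s *\<^sub>R v" "y + t *\<^sub>R v"] st
        by (simp add: algebra_simps)
      finally show ?thesis .
    qed
    then have "q (x + y) - b \<le> q x" if "b \<in> S y" for b
      unfolding q_def[of x] using that by (intro cInf_greatest[OF ne]) (simp add: diff_le_eq)
    then have "q (x + y) - q x \<le> b" if "b \<in> S y" for b using that by (simp add: algebra_simps)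
    then have "q (x + y) - q x \<le> q y"
      unfolding q_def[of y] by (intro cInf_greatest[OF ne])
    then show "q (x + y) \<le> q x + q y" by simp
  next
    fix t :: real and x assume t: "0 < t"
    have "q (t *\<^sub>R x) / t \<le> a" if "a \<in> S x" for a
    proof -
      obtain s where s: "0 \<le> s" "a = p (x + s *\<^sub>R v) - s * p v" using \<open>a \<in> S x\<close> by (auto simp: S_def)
      have "q (t *\<^sub>R x) \<le> p (t *\<^sub>R (x + s *\<^sub>R v)) - (t * s) * p v"
        using upper[of "t * s" "t *\<^sub>R x"] s t by (simp add: algebra_simps)
      also have "\<dots> = t * a" unfolding sublinear_scale[OF p less_imp_le[OF t]] s(2) by (simp add: algebra_simps)
      finally show ?thesis using t by (simp add: field_simps)
    qed
    then have "q (t *\<^sub>R x) / t \<le> q x" unfolding q_def[of x] by (intro cInf_greatest[OF ne])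
    then show "q (t *\<^sub>R x) \<le> t * q x" using t by (simp add: field_simps)
  qed (rule q0)
  \<comment> \<open>The parameter \<open>t = 0\<close> gives domination by \<open>p\<close>;
    \<open>t = 1\<close> at the point \<open>- v\<close> gives the value
    \<open>p 0 - p v\<close>.\<close>
  moreover have "q \<le> p" using upper[of 0] by (auto simp: le_fun_def)
  moreover have "q (- v) \<le> - p v" using upper[of 1 "- v"] sublinear_zero[OF p] by simp
  ultimately show ?thesis by blast
qed

text \<open>Zorn's lemma applies because a nonempty chain has its pointwise infimum as a sublinear
  lower bound. Subadditivity survives the infimum since any two members of a chain can be replaced
  by the smaller one.\<close>

lemma minimal_sublinear_exists:
  fixes p :: "'a::real_vector \<Rightarrow> real"
  assumes p: "sublinear p"
  shows "\<exists>m. sublinear m \<and> m \<le> p \<and> (\<forall>q. sublinear q \<and> q \<le> m \<longrightarrow> q = m)"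
proof -
  define Q where "Q = {q. sublinear q \<and> q \<le> p}"
  \<comment> \<open>The order is reversed for Zorn's lemma, so a maximal element is a minimal
    sublinear functional and chains need lower bounds.\<close>
  have "\<exists>m\<in>Q. \<forall>a\<in>Q. m \<ge> a \<longrightarrow> a = m"
  proof (rule predicate_Zorn)
    show "partial_order_on Q (relation_of (\<lambda>x y. y \<le> x) Q)"
      by (rule partial_order_on_relation_ofI) auto
  next
    fix C assume C: "C \<in> Chains (relation_of (\<lambda>x y. y \<le> x) Q)"
    then have CQ: "C \<subseteq> Q" and chain: "\<And>a b. a \<in> C \<Longrightarrow> b \<in> C \<Longrightarrow> a \<le> b \<or> b \<le> a"
      by (auto simp: Chains_def relation_of_def)
    show "\<exists>u\<in>Q. \<forall>a\<in>C. u \<le> a"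
    proof (cases "C = {}")
      case True
      then show ?thesis using p by (auto simp: Q_def)
    next
      case ne: False
      define u where "u x = (INF q\<in>C. q x)" for x
      \<comment> \<open>All members lie below \<open>p\<close>, so \<open>- p (- x)\<close> is a
        lower bound at \<open>x\<close> common to the whole chain.\<close>
      have bdd: "bdd_below ((\<lambda>q. q x) ` C)" for x
      proof (rule bdd_belowI2)
        fix q assume "q \<in> C"
        then have q: "sublinear q" "q (- x) \<le> p (- x)" using CQ by (auto simp: Q_def le_fun_def)
        show "- p (- x) \<le> q x" using sublinear_minus[OF q(1), of x] q(2) by simp
      qed
      have lower: "u x \<le> q x" if "q \<in> C" for q x
        unfolding u_def by (rule cINF_lower[OF bdd that])
      have "sublinear u"
      proof (rule sublinearI)
        fix x y
        have "u (x + y) \<le> a x + b y" if ab: "a \<in> C" "b \<in> C" for a b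
        proof -
          obtain c where c: "c \<in> C" "c \<le> a" "c \<le> b" using chain[OF ab] ab by blast
          have "u (x + y) \<le> c (x + y)" by (rule lower[OF c(1)])
          also have "\<dots> \<le> c x + c y" using c(1) CQ by (auto simp: Q_def intro: sublinear_add)
          also have "\<dots> \<le> a x + b y" using c by (auto simp: le_fun_def intro: add_mono)
          finally show ?thesis .
        qed
        then have "u (x + y) - b y \<le> u x" if "b \<in> C" for b
          unfolding u_def[of x] using that ne by (intro cINF_greatest) (auto simp: diff_le_eq)
        then have "u (x + y) - u x \<le> b y" if "b \<in> C" for b using that by (simp add: algebra_simps)
        then have "u (x + y) - u x \<le> u y"
          unfolding u_def[of y] using ne by (intro cINF_greatest) auto
        then show "u (x + y) \<le> u x + u y" by simp
      next
        fix t :: real and x assume t: "0 < t"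
        have "u (t *\<^sub>R x) / t \<le> a x" if "a \<in> C" for a
        proof -
          have "sublinear a" using that CQ by (auto simp: Q_def)
          then have "a (t *\<^sub>R x) = t * a x" using t by (intro sublinear_scale) auto
          then show ?thesis using lower[OF that, of "t *\<^sub>R x"] t by (simp add: field_simps)
        qed
        then have "u (t *\<^sub>R x) / t \<le> u x" unfolding u_def[of x] using ne by (intro cINF_greatest) auto
        then show "u (t *\<^sub>R x) \<le> t * u x" using t by (simp add: field_simps)
      next
        have "q 0 = 0" if "q \<in> C" for q using that CQ by (auto simp: Q_def intro: sublinear_zero)
        then have "(\<lambda>q. q 0) ` C = {0}" using ne by (auto simp: image_iff)
        then show "u 0 = 0" by (simp add: u_def)
      qed
      moreover have "u \<le> p"
      proof -
        obtain q where "q \<in> C" using ne by blast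
        then have "u \<le> q" "q \<le> p" using lower CQ by (auto simp: Q_def le_fun_def)
        then show ?thesis by simp
      qed
      ultimately show ?thesis using lower by (auto simp: Q_def le_fun_def)
    qed
  qed
  then show ?thesis by (auto simp: Q_def intro: order_trans)
qed

text \<open>Tilting \<open>p\<close> at \<open>v\<close> before minimising forces the value at
  \<open>v\<close>: the minimal \<open>m\<close> satisfies \<open>m (- v) \<le> - p v\<close>, and
  oddness turns this into \<open>p v \<le> m v\<close>.\<close>

theorem hahn_banach_sublinear:
  fixes p :: "'a::real_vector \<Rightarrow> real"
  assumes p: "sublinear p"
  obtains \<phi> where "linear \<phi>" "\<And>x. \<phi> x \<le> p x" "\<phi> v = p v"
proof -
  obtain q where q: "sublinear q" "q \<le> p" "q (- v) \<le> - p v" using sublinear_tilt[OF p] by blast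
  obtain m where m: "sublinear m" "m \<le> q" and min: "\<And>q. sublinear q \<Longrightarrow> q \<le> m \<Longrightarrow> q = m"
    using minimal_sublinear_exists[OF q(1)] by blast
  have odd: "m (- x) = - m x" for x
  proof (rule antisym)
    \<comment> \<open>A tilt of \<open>m\<close> at \<open>x\<close> lies below \<open>m\<close>, so
      minimality identifies it with \<open>m\<close>, which inherits the inequality at
      \<open>- x\<close>.\<close>
    obtain r where r: "sublinear r" "r \<le> m" "r (- x) \<le> - m x" using sublinear_tilt[OF m(1)] by blast
    then show "m (- x) \<le> - m x" using min by auto
    show "- m x \<le> m (- x)" using sublinear_minus[OF m(1), of "- x"] by simp
  qed
  have "linear m"
  proof (rule linearI)
    fix x y
    have "m (- x + - y) \<le> m (- x) + m (- y)" by (rule sublinear_add[OF m(1)])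
    then have "m x + m y \<le> m (x + y)" using odd[of "x + y"] by (simp add: odd)
    then show "m (x + y) = m x + m y" using sublinear_add[OF m(1), of x y] by simp
  next
    fix c x
    show "m (c *\<^sub>R x) = c *\<^sub>R m x"
    proof (cases "0 \<le> c")
      case False
      then have "m ((- c) *\<^sub>R x) = (- c) * m x" by (intro sublinear_scale[OF m(1)]) simp
      then show ?thesis using odd[of "c *\<^sub>R x"] by simp
    qed (simp add: sublinear_scale[OF m(1)])
  qed
  moreover have le: "m x \<le> p x" for x using m(2) q(2) by (auto simp: le_fun_def intro: order_trans)
  moreover have "m v = p v"
  proof (rule antisym)
    show "p v \<le> m v" using m(2) q(3) odd[of v] by (auto simp: le_fun_def dest!: spec[of _ "- v"])
  qed (rule le)
  ultimately show ?thesis using that by blast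
qed

section \<open>Bounded functionals on normed spaces\<close>

text \<open>A one-sided bound suffices: at \<open>- x\<close> it bounds the functional from
  below.\<close>

lemma blinfun_of_linear:
  fixes \<phi> :: "'a::real_normed_vector \<Rightarrow> real"
  assumes "linear \<phi>" "\<And>x. \<phi> x \<le> K * norm x"
  obtains g :: "'a \<Rightarrow>\<^sub>L real" where "\<And>x. blinfun_apply g x = \<phi> x"
proof -
  have "norm (\<phi> x) \<le> norm x * K" for x
    using assms(2)[of x] assms(2)[of "- x"] linear_neg[OF assms(1), of x] by (simp add: mult.commute)
  then have "bounded_linear \<phi>"
    using assms(1) by (intro bounded_linear_intro[of _ K]) (simp_all add: linear_add linear_scale)
  then show ?thesis using that[of "Blinfun \<phi>"] by (simp add: bounded_linear_Blinfun_apply)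
qed

lemma norming_functional:
  fixes v :: "'a::real_normed_vector"
  obtains g :: "'a \<Rightarrow>\<^sub>L real" where "\<And>x. \<bar>blinfun_apply g x\<bar> \<le> norm x" "blinfun_apply g v = norm v"
proof -
  have "sublinear (norm :: 'a \<Rightarrow> real)" by (simp add: sublinear_def norm_triangle_ineq)
  then obtain \<phi> where \<phi>: "linear \<phi>" "\<And>x. \<phi> x \<le> norm x" "\<phi> v = norm v"
    by (rule hahn_banach_sublinear[of norm v]) blast
  then obtain g :: "'a \<Rightarrow>\<^sub>L real" where g: "\<And>x. blinfun_apply g x = \<phi> x"
    using blinfun_of_linear[of \<phi> 1] by auto
  have "\<bar>blinfun_apply g x\<bar> \<le> norm x" for x
    using \<phi>(2)[of x] \<phi>(2)[of "- x"] linear_neg[OF \<phi>(1), of x] by (simp add: g)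
  then show ?thesis using that[of g] g \<phi>(3) by simp
qed

text \<open>The dominating functional is the distance to \<open>M\<close>: sublinear because
  \<open>M\<close> is a subspace, zero on \<open>M\<close>, positive at \<open>v\<close> because
  \<open>M\<close> is closed, and at most the norm because \<open>M\<close> contains
  \<open>0\<close>.\<close>

lemma separating_functional:
  fixes M :: "'a::real_normed_vector set"
  assumes M: "subspace M" "closed M" and v: "v \<notin> M"
  obtains g :: "'a \<Rightarrow>\<^sub>L real" where "\<And>x. x \<in> M \<Longrightarrow> blinfun_apply g x = 0" "blinfun_apply g v \<noteq> 0"
proof -
  define p where "p x = infdist x M" for x
  have ne: "M \<noteq> {}" using subspace_0[OF M(1)] by blast
  have p_zero: "p x = 0" if "x \<in> M" for x using that by (simp add: p_def)
  have approx: "\<exists>m\<in>M. norm (x - m) < p x + e" if "0 < e" for x e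
  proof -
    have "bdd_below (dist x ` M)" by (rule bdd_belowI2[of _ 0]) simp
    moreover have "(INF m\<in>M. dist x m) < p x + e" using infdist_notempty[OF ne, of x] that by (simp add: p_def)
    ultimately show ?thesis using cINF_less_iff[OF ne, of "dist x" "p x + e"] by (auto simp: dist_norm)
  qed
  have le: "p x \<le> norm (x - m)" if "m \<in> M" for x m
    using infdist_le[OF that, of x] by (simp add: p_def dist_norm)
  have "sublinear p"
  proof (rule sublinearI)
    fix x y
    show "p (x + y) \<le> p x + p y"
    proof (rule field_le_epsilon)
      fix e :: real assume "0 < e"
      then obtain a b where ab: "a \<in> M" "norm (x - a) < p x + e/2" "b \<in> M" "norm (y - b) < p y + e/2"
        using approx[of "e/2"] by (meson half_gt_zero)
      have "p (x + y) \<le> norm ((x + y) - (a + b))" using ab subspace_add[OF M(1)] by (intro le) auto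
      also have "\<dots> \<le> norm (x - a) + norm (y - b)" by (metis add_diff_add norm_triangle_ineq)
      finally show "p (x + y) \<le> p x + p y + e" using ab by simp
    qed
  next
    fix t :: real and x assume t: "0 < t"
    show "p (t *\<^sub>R x) \<le> t * p x"
    proof (rule field_le_epsilon)
      fix e :: real assume "0 < e"
      then obtain a where a: "a \<in> M" "norm (x - a) < p x + e / t" using approx[of "e/t"] t by auto
      have "p (t *\<^sub>R x) \<le> norm (t *\<^sub>R x - t *\<^sub>R a)" using a subspace_scale[OF M(1)] by (intro le) auto
      also have "\<dots> = t * norm (x - a)" using t by (simp flip: scaleR_diff_right)
      also have "\<dots> \<le> t * (p x + e / t)" using a t by (intro mult_left_mono) auto
      also have "\<dots> = t * p x + e" using t by (simp add: field_simps)
      finally show "p (t *\<^sub>R x) \<le> t * p x + e" .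
    qed
  qed (simp add: p_zero subspace_0[OF M(1)])
  then obtain \<phi> where \<phi>: "linear \<phi>" "\<And>x. \<phi> x \<le> p x" "\<phi> v = p v"
    by (rule hahn_banach_sublinear[of p v]) blast
  have "\<phi> x \<le> 1 * norm x" for x
    using \<phi>(2)[of x] le[OF subspace_0[OF M(1)], of x] by simp
  then obtain g :: "'a \<Rightarrow>\<^sub>L real" where g: "\<And>x. blinfun_apply g x = \<phi> x"
    using blinfun_of_linear[OF \<phi>(1)] by blast
  have "\<phi> x = 0" if "x \<in> M" for x
    using \<phi>(2)[of x] \<phi>(2)[of "- x"] linear_neg[OF \<phi>(1), of x] p_zero[OF that]
      p_zero[OF subspace_neg[OF M(1) that]] by simp
  moreover have "\<phi> v > 0"
    using infdist_pos_not_in_closed[OF M(2) ne v] by (simp add: \<phi>(3) p_def)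
  ultimately show ?thesis using that[of g] by (auto simp: g)
qed

section \<open>Weak convergence in reflexive spaces\<close>

text \<open>Eventual membership passes from preimages under single functionals to the finite
  intersections and unions that they generate.\<close>

lemma weak_lim_iff:
  fixes x :: "'a::real_normed_vector"
  shows "weak_lim xs x \<longleftrightarrow> (\<forall>g :: 'a \<Rightarrow>\<^sub>L real. (\<lambda>n. blinfun_apply g (xs n)) \<longlonglongrightarrow> blinfun_apply g x)"
proof
  assume L: "weak_lim xs x"
  show "\<forall>g :: 'a \<Rightarrow>\<^sub>L real. (\<lambda>n. blinfun_apply g (xs n)) \<longlonglongrightarrow> blinfun_apply g x"
  proof (intro allI topological_tendstoI)
    fix g :: "'a \<Rightarrow>\<^sub>L real" and U :: "real set" assume U: "open U" "blinfun_apply g x \<in> U"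
    have "openin weak_topology (blinfun_apply g -` U)"
      unfolding weak_topology_def using U(1) by (intro topology_generated_by_Basis) auto
    then have "\<forall>\<^sub>F n in sequentially. xs n \<in> blinfun_apply g -` U"
      using L U(2) by (auto simp: weak_lim_def limitin_def)
    then show "\<forall>\<^sub>F n in sequentially. blinfun_apply g (xs n) \<in> U" by simp
  qed
next
  assume L: "\<forall>g :: 'a \<Rightarrow>\<^sub>L real. (\<lambda>n. blinfun_apply g (xs n)) \<longlonglongrightarrow> blinfun_apply g x"
  \<comment> \<open>The preimage of \<open>UNIV\<close> under the zero functional shows that the
    topology lives on the whole space.\<close>
  have "openin weak_topology (blinfun_apply (0 :: 'a \<Rightarrow>\<^sub>L real) -` UNIV)"
    unfolding weak_topology_def by (intro topology_generated_by_Basis) blast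
  then have "x \<in> topspace weak_topology" using openin_subset by fastforce
  moreover have "\<forall>\<^sub>F n in sequentially. xs n \<in> V" if V: "openin weak_topology V" "x \<in> V" for V
  proof -
    have "generate_topology_on {blinfun_apply g -` U | (g :: 'a \<Rightarrow>\<^sub>L real) U. open U} V"
      using V(1) unfolding weak_topology_def by (rule openin_topology_generated_by)
    then show ?thesis using V(2)
    proof induction
      case (Int a b)
      then show ?case by (auto intro: eventually_conj)
    next
      case (UN K)
      then obtain k where "k \<in> K" "x \<in> k" by blast
      then show ?case using UN.IH[of k] by (auto elim: eventually_mono)
    next
      case (Basis s)
      then obtain g :: "'a \<Rightarrow>\<^sub>L real" and U where U: "s = blinfun_apply g -` U" "open U" by blast
      have "\<forall>\<^sub>F n in sequentially. blinfun_apply g (xs n) \<in> U"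
        using L U Basis.prems by (intro topological_tendstoD[of _ "blinfun_apply g x"]) auto
      then show ?case by (simp add: U(1))
    qed simp
  qed
  ultimately show "weak_lim xs x" by (simp add: weak_lim_def limitin_def)
qed

lemma weak_lim_strong: "xs \<longlonglongrightarrow> x \<Longrightarrow> weak_lim xs x"
  by (simp add: weak_lim_iff blinfun.tendsto)

text \<open>If convergence failed, infinitely many terms would avoid a neighbourhood of
  \<open>l\<close>; they form a subsequence without any further subsequence tending to
  \<open>l\<close>.\<close>

lemma subseq_tendstoI:
  fixes X :: "nat \<Rightarrow> 'a::topological_space"
  assumes "\<And>r::nat \<Rightarrow> nat. strict_mono r \<Longrightarrow> \<exists>s::nat \<Rightarrow> nat. strict_mono s \<and> (\<lambda>n. X (r (s n))) \<longlonglongrightarrow> l"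
  shows "X \<longlonglongrightarrow> l"
proof (rule ccontr)
  assume "\<not> X \<longlonglongrightarrow> l"
  then obtain U where U: "open U" "l \<in> U" "\<not> (\<forall>\<^sub>F n in sequentially. X n \<in> U)"
    by (auto simp: tendsto_def)
  then have "\<exists>\<^sub>F n in sequentially. X n \<notin> U" by (simp add: frequently_def)
  then have "infinite {n. X n \<notin> U}" by (simp add: frequently_cofinite flip: cofinite_eq_sequentially)
  then obtain r :: "nat \<Rightarrow> nat" where r: "strict_mono r" "\<And>n. X (r n) \<notin> U"
    using infinite_enumerate by blast
  obtain s :: "nat \<Rightarrow> nat" where "(\<lambda>n. X (r (s n))) \<longlonglongrightarrow> l" using assms[OF r(1)] by blast
  then have "\<forall>\<^sub>F n in sequentially. X (r (s n)) \<in> U" using U(1,2) by (rule topological_tendstoD)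
  then show False using r(2) by simp
qed

section \<open>Weak sequential compactness\<close>

text \<open>Finite rational combinations, coded by lists, form a countable set closed under addition
  (concatenation) and rational scaling. Density of the rationals makes its closure a real
  subspace.\<close>

lemma countable_subspace_hull:
  fixes xs :: "nat \<Rightarrow> 'a::real_normed_vector"
  obtains D where "countable D" "range xs \<subseteq> D" "subspace (closure D)"
proof -
  define c where "c l = (\<Sum>(q, n)\<leftarrow>l. of_rat q *\<^sub>R xs n)" for l :: "(rat \<times> nat) list"
  define D where "D = range c"
  have add: "x + y \<in> D" if xy: "x \<in> D" "y \<in> D" for x y
  proof -
    obtain l k where "x = c l" "y = c k" using xy by (auto simp: D_def)
    then have "x + y = c (l @ k)" by (simp add: c_def)
    then show ?thesis by (simp add: D_def)
  qed
  have scale: "real_of_rat q *\<^sub>R x \<in> D" if x: "x \<in> D" for q x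
  proof -
    obtain l where l: "x = c l" using x by (auto simp: D_def)
    have "real_of_rat q *\<^sub>R c l = c (map (\<lambda>(a, n). (q * a, n)) l)"
      by (induction l) (auto simp: c_def scaleR_right_distrib of_rat_mult)
    then show ?thesis by (auto simp: D_def l)
  qed
  have "c [(1, n)] = xs n" for n by (simp add: c_def)
  then have xs: "range xs \<subseteq> D" by (metis D_def image_subsetI rangeI)
  have "subspace (closure D)"
  proof (rule subspaceI)
    have "c [] = 0" by (simp add: c_def)
    then have "0 \<in> D" by (metis D_def rangeI)
    then show "0 \<in> closure D" using closure_subset by blast
  next
    fix x y assume "x \<in> closure D" "y \<in> closure D"
    then obtain u v where "\<And>n. u n \<in> D" "u \<longlonglongrightarrow> x" "\<And>n. v n \<in> D" "v \<longlonglongrightarrow> y"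
      by (auto simp: closure_sequential)
    then show "x + y \<in> closure D"
      unfolding closure_sequential by (intro exI[of _ "\<lambda>n. u n + v n"]) (auto intro: add tendsto_add)
  next
    fix t :: real and x assume "x \<in> closure D"
    then obtain u where u: "\<And>n. u n \<in> D" "u \<longlonglongrightarrow> x" by (auto simp: closure_sequential)
    have "t \<in> closure \<rat>" by (simp add: Rats_closure_real)
    then obtain q where q: "\<And>n. q n \<in> \<rat>" "q \<longlonglongrightarrow> t" by (auto simp: closure_sequential)
    have "q n *\<^sub>R u n \<in> D" for n using q(1)[of n] scale[OF u(1)] by (auto elim!: Rats_cases)
    then show "t *\<^sub>R x \<in> closure D"
      unfolding closure_sequential using u q
      by (intro exI[of _ "\<lambda>n. q n *\<^sub>R u n"]) (auto intro: tendsto_scaleR)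
  qed
  with xs show ?thesis using that[of D] by (simp add: D_def)
qed

text \<open>The condition says \<open>g z \<le> limsup g (xs n)\<close> for each single
  \<open>g\<close>, which is the form delivered by a functional dominated by the limsup. It places
  \<open>z\<close> in the closed convex hull of every tail and does not require a subsequence to
  converge to \<open>z\<close>.\<close>

definition weak_cluster :: "(nat \<Rightarrow> 'x::real_normed_vector) \<Rightarrow> 'x \<Rightarrow> bool" where
  "weak_cluster xs z \<longleftrightarrow> (\<forall>(g :: 'x \<Rightarrow>\<^sub>L real) c.
     (\<forall>\<^sub>F n in sequentially. blinfun_apply g (xs n) \<le> c) \<longrightarrow> blinfun_apply g z \<le> c)"

text \<open>By Hahn--Banach some functional on the dual is dominated by \<open>g \<mapsto> limsup g (x\<^sub>n)\<close>, and
  reflexivity represents it by a point.\<close>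

lemma weak_cluster_point:
  fixes xs :: "nat \<Rightarrow> 'x::real_normed_vector"
  assumes refl: "reflexive_space TYPE('x)" and bdd: "bounded (range xs)"
  obtains z where "weak_cluster (\<lambda>n. xs n) z"
proof -
  obtain K where K: "\<And>n. norm (xs n) \<le> K" using bdd by (auto simp: bounded_iff)
  \<comment> \<open>\<open>S g\<close> collects the eventual upper bounds, so its infimum is the
    limsup; the bound \<open>K\<close> keeps it finite.\<close>
  define S where "S g = {c. \<forall>\<^sub>F n in sequentially. blinfun_apply g (xs n) \<le> c}" for g :: "'x \<Rightarrow>\<^sub>L real"
  define p where "p g = Inf (S g)" for g
  have abs: "\<bar>blinfun_apply g (xs n)\<bar> \<le> K * norm g" for g :: "'x \<Rightarrow>\<^sub>L real" and n
    using norm_blinfun[of g "xs n"] mult_left_mono[OF K[of n] norm_ge_zero[of g]] by (simp add: mult.commute)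
  have in_S: "K * norm g \<in> S g" for g
    using abs_le_D1[OF abs] by (simp add: S_def)
  then have ne: "S g \<noteq> {}" for g by blast
  have lower: "- (K * norm g) \<le> c" if c: "c \<in> S g" for g c
  proof -
    have "\<forall>\<^sub>F n in sequentially. blinfun_apply g (xs n) \<le> c" using c by (simp add: S_def)
    then obtain n where "blinfun_apply g (xs n) \<le> c" by (meson eventually_sequentially order_refl)
    then show ?thesis using abs[of g n] by linarith
  qed
  have bdd: "bdd_below (S g)" for g by (rule bdd_belowI[OF lower])
  have upper: "p g \<le> c" if "c \<in> S g" for g c unfolding p_def by (rule cInf_lower[OF that bdd])
  have "sublinear p"
  proof (rule sublinearI)
    fix g h
    have "p (g + h) \<le> a + b" if "a \<in> S g" "b \<in> S h" for a b
    proof (rule upper)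
      show "a + b \<in> S (g + h)" using that unfolding S_def mem_Collect_eq
        by eventually_elim (simp add: blinfun.add_left)
    qed
    then have "p (g + h) - b \<le> p g" if "b \<in> S h" for b
      unfolding p_def[of g] using that by (intro cInf_greatest[OF ne]) (simp add: diff_le_eq)
    then have "p (g + h) - p g \<le> b" if "b \<in> S h" for b using that by (simp add: algebra_simps)
    then have "p (g + h) - p g \<le> p h" unfolding p_def[of h] by (intro cInf_greatest[OF ne])
    then show "p (g + h) \<le> p g + p h" by simp
  next
    fix t :: real and g assume t: "0 < t"
    have "p (t *\<^sub>R g) / t \<le> a" if "a \<in> S g" for a
    proof -
      have "t * a \<in> S (t *\<^sub>R g)" using that t unfolding S_def mem_Collect_eq
        by (auto elim!: eventually_mono simp: blinfun.scaleR_left)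
      from upper[OF this] show ?thesis using t by (simp add: field_simps)
    qed
    then have "p (t *\<^sub>R g) / t \<le> p g" unfolding p_def[of g] by (intro cInf_greatest[OF ne])
    then show "p (t *\<^sub>R g) \<le> t * p g" using t by (simp add: field_simps)
  next
    show "p 0 = 0"
      proof (rule antisym)
      show "p 0 \<le> 0" using upper[OF in_S, of 0] by simp
      show "0 \<le> p 0" unfolding p_def using lower[of _ 0] by (intro cInf_greatest[OF ne]) simp
    qed
  qed
  \<comment> \<open>Any dominated functional will do, so the prescribed value is taken at
    \<open>0\<close>.\<close>
  then obtain \<phi> where \<phi>: "linear \<phi>" "\<And>g. \<phi> g \<le> p g"
    by (rule hahn_banach_sublinear[of p 0]) blast
  have "\<phi> g \<le> K * norm g" for g using \<phi>(2)[of g] upper[OF in_S, of g] by linarith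
  then obtain \<Phi> :: "('x \<Rightarrow>\<^sub>L real) \<Rightarrow>\<^sub>L real" where \<Phi>: "\<And>g. blinfun_apply \<Phi> g = \<phi> g"
    using blinfun_of_linear[OF \<phi>(1)] by blast
  obtain z where z: "\<And>g. blinfun_apply \<Phi> g = blinfun_apply g z"
    using refl unfolding reflexive_space_def by metis
  have "blinfun_apply g z \<le> c" if "\<forall>\<^sub>F n in sequentially. blinfun_apply g (xs n) \<le> c" for g :: "'x \<Rightarrow>\<^sub>L real" and c
    using \<phi>(2)[of g] upper[of c g] that by (simp add: S_def \<Phi> flip: z)
  then show ?thesis by (intro that[of z]) (simp add: weak_cluster_def)
qed

text \<open>Every \<open>l + e\<close> is an eventual upper bound for \<open>g\<close>, and the same
  argument for \<open>- g\<close> gives the other inequality.\<close>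

lemma weak_cluster_point_limit:
  fixes g :: "'x::real_normed_vector \<Rightarrow>\<^sub>L real"
  assumes z: "weak_cluster (\<lambda>n. xs n) z"
    and lim: "(\<lambda>n. blinfun_apply g (xs n)) \<longlonglongrightarrow> l"
  shows "blinfun_apply g z = l"
proof -
  have le: "blinfun_apply h z \<le> m" if "(\<lambda>n. blinfun_apply h (xs n)) \<longlonglongrightarrow> m" for h :: "'x \<Rightarrow>\<^sub>L real" and m
  proof (rule field_le_epsilon)
    fix e :: real assume "0 < e"
    then have "\<forall>\<^sub>F n in sequentially. blinfun_apply h (xs n) < m + e"
      using order_tendstoD(2)[OF that, of "m + e"] by simp
    then have "\<forall>\<^sub>F n in sequentially. blinfun_apply h (xs n) \<le> m + e" by (rule eventually_mono) simp
    then show "blinfun_apply h z \<le> m + e" using z by (simp add: weak_cluster_def)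
  qed
  have "(\<lambda>n. blinfun_apply (- g) (xs n)) \<longlonglongrightarrow> - l" using tendsto_minus[OF lim] by (simp add: blinfun.minus_left)
  then show ?thesis using le[OF lim] le[of "- g" "- l"] by (simp add: blinfun.minus_left)
qed

text \<open>A diagonal subsequence makes countably many functionals converge that separate the points
  of the closed span. All weak cluster points of its subsequences then coincide.\<close>

lemma weakly_convergent_subsequence:
  fixes xs :: "nat \<Rightarrow> 'x::real_normed_vector"
  assumes refl: "reflexive_space TYPE('x)" and bdd: "bounded (range xs)"
  obtains r :: "nat \<Rightarrow> nat" and x where "strict_mono r" "weak_lim (\<lambda>n. xs (r n)) x"
proof -
  obtain K where K: "\<And>n. norm (xs n) \<le> K" using bdd by (auto simp: bounded_iff)
  have bdd_sub: "bounded (range (\<lambda>n. xs (s n)))" for s :: "nat \<Rightarrow> nat"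
    using bdd by (rule bounded_subset) auto
  have bdd_fun: "bounded (range (\<lambda>n. blinfun_apply g (xs (s n))))" for g :: "'x \<Rightarrow>\<^sub>L real" and s :: "nat \<Rightarrow> nat"
    using bounded_linear_image[OF bdd_sub[of s] blinfun.bounded_linear_right[of g]]
    by (simp add: image_image)
  obtain D where D: "countable D" "range xs \<subseteq> D" "subspace (closure D)"
    by (rule countable_subspace_hull)
  have Dne: "D \<noteq> {}" using D(2) by blast
  \<comment> \<open>One norming functional is chosen for each point of the countable set
    \<open>D\<close>.\<close>
  define h :: "nat \<Rightarrow> 'x \<Rightarrow>\<^sub>L real" where
    "h k = (SOME g. (\<forall>x. \<bar>blinfun_apply g x\<bar> \<le> norm x) \<and> blinfun_apply g (from_nat_into D k) = norm (from_nat_into D k))" for k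
  have h: "(\<forall>x. \<bar>blinfun_apply (h k) x\<bar> \<le> norm x) \<and> blinfun_apply (h k) (from_nat_into D k) = norm (from_nat_into D k)" for k
    unfolding h_def
  proof (rule someI_ex)
    obtain g :: "'x \<Rightarrow>\<^sub>L real" where "\<And>x. \<bar>blinfun_apply g x\<bar> \<le> norm x" "blinfun_apply g (from_nat_into D k) = norm (from_nat_into D k)"
      using norming_functional[of "from_nat_into D k"] by blast
    then show "\<exists>g :: 'x \<Rightarrow>\<^sub>L real. (\<forall>x. \<bar>blinfun_apply g x\<bar> \<le> norm x) \<and> blinfun_apply g (from_nat_into D k) = norm (from_nat_into D k)"
      by blast
  qed
  have h_separates: "d = 0" if d: "d \<in> closure D" "\<And>k. blinfun_apply (h k) d = 0" for d
  proof -
    have "norm d \<le> e" if "0 < e" for e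
    proof -
      \<comment> \<open>The functional norming a nearby \<open>y\<close> vanishes at
        \<open>d\<close>, so \<open>norm y\<close> is at most \<open>norm (y - d)\<close>, and
        \<open>d\<close> is small as well.\<close>
      obtain y where y: "y \<in> D" "dist y d < e/2" using d(1) \<open>0 < e\<close> by (auto simp: closure_approachable dest: spec[of _ "e/2"])
      obtain k where k: "y = from_nat_into D k" using from_nat_into_surj[OF D(1) y(1)] by metis
      have "norm y = blinfun_apply (h k) (y - d)" using h[of k] d(2)[of k] by (simp add: k blinfun.diff_right)
      also have "\<dots> \<le> norm (y - d)" using h[of k] abs_le_D1 by blast
      finally have "norm y < e/2" using y(2) by (simp add: dist_norm)
      moreover have "norm d \<le> norm y + norm (y - d)" by norm
      ultimately show ?thesis using y(2) by (simp add: dist_norm)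
    qed
    then show ?thesis using field_le_epsilon[of "norm d" 0] by simp
  qed
  interpret subseqs "\<lambda>k s. convergent (\<lambda>n. blinfun_apply (h k) (xs (s n)))"
  proof
    fix k and s :: "nat \<Rightarrow> nat"
    obtain l r where "strict_mono (r::nat\<Rightarrow>nat)" "((\<lambda>n. blinfun_apply (h k) (xs (s n))) \<circ> r) \<longlonglongrightarrow> l"
      using bounded_imp_convergent_subsequence[OF bdd_fun[of "h k" s]] by blast
    then show "\<exists>r'. strict_mono r' \<and> convergent (\<lambda>n. blinfun_apply (h k) (xs ((s \<circ> r') n)))"
      by (auto simp: o_def convergent_def)
  qed
  define ys where "ys n = xs (diagseq n)" for n
  \<comment> \<open>The diagonal sequence is guaranteed to refine the \<open>k\<close>-th selection
    only from index \<open>Suc k\<close> on; the initial segment does not affect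
    convergence.\<close>
  have "convergent (\<lambda>n. blinfun_apply (h k) (xs ((diagseq \<circ> ((+) (Suc k))) n)))" for k
  proof (rule diagseq_holds)
    show "convergent (\<lambda>n. blinfun_apply (h j) (xs ((s \<circ> r) n)))"
      if "strict_mono (r::nat\<Rightarrow>nat)" "convergent (\<lambda>n. blinfun_apply (h j) (xs (s n)))" for r s j
      using convergent_subseq_convergent[OF that(2,1)] by (simp add: o_def)
  qed
  then have "convergent (\<lambda>n. blinfun_apply (h k) (ys (n + Suc k)))" for k
    unfolding ys_def comp_def by (simp only: add.commute[of _ "Suc k"])
  then have "convergent (\<lambda>n. blinfun_apply (h k) (ys n))" for k
    by (rule iffD1[OF convergent_ignore_initial_segment[where f = "\<lambda>n. blinfun_apply (h k) (ys n)" and m = "Suc k"]])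
  then have L: "(\<lambda>n. blinfun_apply (h k) (ys n)) \<longlonglongrightarrow> lim (\<lambda>n. blinfun_apply (h k) (ys n))" for k
    by (simp add: convergent_LIMSEQ_iff)
  \<comment> \<open>Otherwise some functional vanishes along the sequence but not at
    \<open>z\<close>.\<close>
  have in_span: "z \<in> closure D"
    if z: "weak_cluster (\<lambda>n. ys (s n)) z" for z and s :: "nat \<Rightarrow> nat"
  proof (rule ccontr)
    assume "z \<notin> closure D"
    then obtain g :: "'x \<Rightarrow>\<^sub>L real" where g: "\<And>x. x \<in> closure D \<Longrightarrow> blinfun_apply g x = 0" "blinfun_apply g z \<noteq> 0"
      using separating_functional[OF D(3) closed_closure] by blast
    have "ys n \<in> closure D" for n using D(2) closure_subset by (auto simp: ys_def)
    then have "(\<lambda>n. blinfun_apply g (ys (s n))) \<longlonglongrightarrow> 0" by (simp add: g(1))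
    from weak_cluster_point_limit[OF z this] g(2) show False by simp
  qed
  have bdd_ys: "bounded (range (\<lambda>n. ys (s n)))" for s :: "nat \<Rightarrow> nat" unfolding ys_def by (rule bdd_sub)
  obtain z where z: "weak_cluster (\<lambda>n. ys n) z"
    by (rule weak_cluster_point[OF refl bdd_ys[of id, unfolded id_apply]])
  have "(\<lambda>n. blinfun_apply g (ys n)) \<longlonglongrightarrow> blinfun_apply g z" for g :: "'x \<Rightarrow>\<^sub>L real"
  proof (rule subseq_tendstoI)
    fix r :: "nat \<Rightarrow> nat" assume r: "strict_mono r"
    have "bounded (range (\<lambda>n. blinfun_apply g (ys (r n))))" unfolding ys_def by (rule bdd_fun)
    then obtain l s where s: "strict_mono (s::nat\<Rightarrow>nat)" "(\<lambda>n. blinfun_apply g (ys (r (s n)))) \<longlonglongrightarrow> l"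
      using bounded_imp_convergent_subsequence[of "\<lambda>n. blinfun_apply g (ys (r n))"] by (auto simp: o_def)
    obtain w where w: "weak_cluster (\<lambda>n. ys (r (s n))) w"
      by (rule weak_cluster_point[OF refl bdd_ys[of "\<lambda>n. r (s n)"]])
    have "blinfun_apply (h k) (z - w) = 0" for k
    proof -
      have "(\<lambda>n. blinfun_apply (h k) (ys (r (s n)))) \<longlonglongrightarrow> lim (\<lambda>n. blinfun_apply (h k) (ys n))"
        using LIMSEQ_subseq_LIMSEQ[OF L strict_mono_o[OF r s(1)], of k] by (simp add: o_def)
      then show ?thesis
        using weak_cluster_point_limit[OF w, of "h k"] weak_cluster_point_limit[OF z L[of k]]
        by (simp only: blinfun.diff_right)
    qed
    moreover have "z - w \<in> closure D"
      using in_span[of id z] in_span[of "\<lambda>n. r (s n)" w] z w by (simp add: subspace_diff[OF D(3)])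
    ultimately have "z = w" using h_separates[of "z - w"] by simp
    then have "blinfun_apply g z = l" using weak_cluster_point_limit[OF w s(2)] by simp
    with s show "\<exists>s. strict_mono s \<and> (\<lambda>n. blinfun_apply g (ys (r (s n)))) \<longlonglongrightarrow> blinfun_apply g z" by blast
  qed
  then have "weak_lim (\<lambda>n. xs (diagseq n)) z" by (simp add: weak_lim_iff ys_def)
  then show ?thesis using that subseq_diagseq by blast
qed

section \<open>Weak limits under bounded linear maps and lower semicontinuity\<close>

text \<open>Pulling back along \<open>L\<close> a functional that norms \<open>L v\<close> reduces
  statements about \<open>norm (L x)\<close> under weak convergence to a single scalar
  sequence.\<close>

lemma norming_functional_through:
  fixes L :: "'x::real_normed_vector \<Rightarrow> 'y::real_normed_vector"
  assumes L: "bounded_linear L"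
  obtains g :: "'x \<Rightarrow>\<^sub>L real" where "\<And>x. \<bar>blinfun_apply g x\<bar> \<le> norm (L x)" "blinfun_apply g v = norm (L v)"
proof -
  obtain h :: "'y \<Rightarrow>\<^sub>L real" where h: "\<And>x. \<bar>blinfun_apply h x\<bar> \<le> norm x" "blinfun_apply h (L v) = norm (L v)"
    using norming_functional[of "L v"] by blast
  have "blinfun_apply (Blinfun (\<lambda>x. blinfun_apply h (L x))) = (\<lambda>x. blinfun_apply h (L x))"
    by (intro bounded_linear_Blinfun_apply bounded_linear_compose[OF blinfun.bounded_linear_right L])
  then show ?thesis using that[of "Blinfun (\<lambda>x. blinfun_apply h (L x))"] h by simp
qed

lemma weak_lim_kernel:
  fixes L :: "'x::real_normed_vector \<Rightarrow> 'y::real_normed_vector"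
  assumes L: "bounded_linear L" and xs: "weak_lim xs x" and lim: "(\<lambda>n. norm (L (xs n))) \<longlonglongrightarrow> 0"
  shows "L x = 0"
proof -
  obtain g :: "'x \<Rightarrow>\<^sub>L real" where g: "\<And>x. \<bar>blinfun_apply g x\<bar> \<le> norm (L x)" "blinfun_apply g x = norm (L x)"
    using norming_functional_through[OF L, of x] by blast
  have "(\<lambda>n. blinfun_apply g (xs n)) \<longlonglongrightarrow> 0"
    by (rule Lim_null_comparison[OF _ lim]) (simp add: g(1))
  moreover have "(\<lambda>n. blinfun_apply g (xs n)) \<longlonglongrightarrow> norm (L x)"
    using xs by (simp add: weak_lim_iff flip: g(2))
  ultimately show ?thesis using LIMSEQ_unique by fastforce
qed

text \<open>This is weak lower semicontinuity of \<open>norm (L x)\<close>. For the trace map it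
  keeps the penalty term away from zero when the weak limit lies outside the kernel.\<close>

lemma weak_lim_norm_bound:
  fixes L :: "'x::real_normed_vector \<Rightarrow> 'y::real_normed_vector"
  assumes L: "bounded_linear L" and xs: "weak_lim xs x" and a: "a < norm (L x)"
  shows "\<forall>\<^sub>F n in sequentially. a < norm (L (xs n))"
proof -
  obtain g :: "'x \<Rightarrow>\<^sub>L real" where g: "\<And>x. \<bar>blinfun_apply g x\<bar> \<le> norm (L x)" "blinfun_apply g x = norm (L x)"
    using norming_functional_through[OF L, of x] by blast
  have "(\<lambda>n. blinfun_apply g (xs n)) \<longlonglongrightarrow> norm (L x)"
    using xs by (simp add: weak_lim_iff flip: g(2))
  from order_tendstoD(1)[OF this a] show ?thesis
  proof eventually_elim
    case (elim n)
    then show ?case using g(1)[of "xs n"] by linarith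
  qed
qed

lemma weakly_lsc_eventually:
  assumes "weakly_lsc E" "weak_lim xs x" "r < E x"
  shows "\<forall>\<^sub>F n in sequentially. r < E (xs n)"
proof -
  have "openin weak_topology {x. r < E x}" "x \<in> {x. r < E x}"
    using assms by (auto simp: weakly_lsc_def)
  then have "\<forall>\<^sub>F n in sequentially. xs n \<in> {x. r < E x}"
    using assms(2) unfolding weak_lim_def limitin_def by blast
  then show ?thesis by simp
qed

section \<open>The penalised energies\<close>

lemma penalised_liminf:
  fixes f :: "'x::real_normed_vector \<Rightarrow>\<^sub>L real" and \<gamma> :: "'x \<Rightarrow> 'b::real_normed_vector"
  assumes lsc: "weakly_lsc E" and E: "\<And>x. e0 \<le> E x" and \<gamma>: "bounded_linear \<gamma>"
    and xs: "weak_lim xs x" and N: "filterlim N at_top sequentially"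
  shows "limit_energy {x. \<gamma> x = 0} E (blinfun_apply f) x
    \<le> liminf (\<lambda>n. ereal (E (xs n) + N n * (norm (\<gamma> (xs n)))\<^sup>2 - blinfun_apply f (xs n)))"
proof -
  have N_ge: "\<forall>\<^sub>F n in sequentially. c \<le> N n" for c
    using N by (simp add: filterlim_at_top)
  have f_less: "\<forall>\<^sub>F n in sequentially. blinfun_apply f (xs n) < blinfun_apply f x + e" if "0 < e" for e
    using xs that by (intro order_tendstoD(2)[of _ "blinfun_apply f x"]) (auto simp: weak_lim_iff)
  have "\<forall>\<^sub>F n in sequentially. y < ereal (E (xs n) + N n * (norm (\<gamma> (xs n)))\<^sup>2 - blinfun_apply f (xs n))"
    if y: "y < limit_energy {x. \<gamma> x = 0} E (blinfun_apply f) x" for y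
  proof (cases y)
    case (real r)
    show ?thesis
    proof (cases "\<gamma> x = 0")
      case True
      \<comment> \<open>The gap between the limit value and \<open>r\<close> is shared equally
        between the errors in \<open>E\<close> and in \<open>f\<close>.\<close>
      define e where "e = (E x - blinfun_apply f x - r) / 2"
      have e: "0 < e" "E x - e - (blinfun_apply f x + e) = r"
        using y True by (simp_all add: real limit_energy_def e_def field_simps)
      have "\<forall>\<^sub>F n in sequentially. E x - e < E (xs n)"
        using e by (intro weakly_lsc_eventually[OF lsc xs]) simp
      then show ?thesis using f_less[OF e(1)] N_ge[of 0]
      proof eventually_elim
        case (elim n)
        have "0 \<le> N n * (norm (\<gamma> (xs n)))\<^sup>2" using elim by simp
        then have "r < E (xs n) + N n * (norm (\<gamma> (xs n)))\<^sup>2 - blinfun_apply f (xs n)"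
          using elim e(2) by linarith
        then show ?case by (simp add: real)
      qed
    next
      case False
      define a where "a = norm (\<gamma> x) / 2"
      have a: "0 < a" "a < norm (\<gamma> x)" using False by (simp_all add: a_def)
      \<comment> \<open>With this weight the penalty \<open>c * a\<^sup>2\<close> outweighs
        \<open>r\<close>, the lower bound \<open>e0\<close> and the eventual bound
        \<open>f x + 1\<close>. The maximum with \<open>0\<close> permits multiplying the
        estimates.\<close>
      define c where "c = max 0 ((r - e0 + blinfun_apply f x + 1) / a\<^sup>2)"
      show ?thesis using f_less[of 1, simplified] N_ge[of c] weak_lim_norm_bound[OF \<gamma> xs a(2)]
      proof eventually_elim
        case (elim n)
        have "(r - e0 + blinfun_apply f x + 1) / a\<^sup>2 \<le> c" unfolding c_def by (rule max.cobounded2)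
        then have "r - e0 + blinfun_apply f x + 1 \<le> c * a\<^sup>2" using a by (simp add: pos_divide_le_eq)
        also have "c * a\<^sup>2 \<le> N n * (norm (\<gamma> (xs n)))\<^sup>2"
          using elim a by (intro mult_mono power_mono) (auto simp: c_def)
        finally show ?case using elim E[of "xs n"] by (simp add: real)
      qed
    qed
  qed (use y in auto)
  then show ?thesis by (simp add: le_Liminf_iff)
qed

section \<open>Coercivity\<close>

lemma energy_coercive:
  fixes T :: "'x::real_normed_vector \<Rightarrow> 'y::real_normed_vector"
    and \<gamma> :: "'x \<Rightarrow> 'b::real_normed_vector" and f :: "'x \<Rightarrow>\<^sub>L real"
  assumes refl: "reflexive_space TYPE('x)" and T: "bounded_linear T"
    and norm: "\<And>x. norm x = snorm x + norm (T x)"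
    and compact: "\<And>xs x. weak_lim xs x \<Longrightarrow> (\<lambda>n. snorm (xs n - x)) \<longlonglongrightarrow> 0"
    and \<gamma>: "bounded_linear \<gamma>"
    and ker: "bounded ({x. (norm (\<gamma> x))\<^sup>2 - blinfun_apply f x \<le> 0} \<inter> {x. T x = 0})"
    and E: "\<And>x. e0 \<le> E x"
    and growth: "p > 1" "c\<^sub>1 > 0" "\<And>x. \<bar>E x\<bar> \<ge> c\<^sub>1 * norm (T x) powr p - c\<^sub>2"
  shows "bounded {x. E x + (norm (\<gamma> x))\<^sup>2 - blinfun_apply f x \<le> C}"
proof (rule ccontr)
  interpret T: bounded_linear T by (rule T)
  interpret \<gamma>: bounded_linear \<gamma> by (rule \<gamma>)
  have ker_nonneg: "y = 0" if y: "\<gamma> y = 0" "T y = 0" "0 \<le> blinfun_apply f y" for y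
  proof (rule ccontr)
    assume "y \<noteq> 0"
    obtain B where B: "\<And>x. (norm (\<gamma> x))\<^sup>2 - blinfun_apply f x \<le> 0 \<Longrightarrow> T x = 0 \<Longrightarrow> norm x \<le> B"
      using ker by (auto simp: bounded_iff)
    \<comment> \<open>The multiple of \<open>y\<close> with norm \<open>\<bar>B\<bar> + 1\<close>
      still lies in the kernels and has nonnegative \<open>f\<close>, so it belongs to the bounded
      set.\<close>
    have "norm (((\<bar>B\<bar> + 1) / norm y) *\<^sub>R y) \<le> B"
      by (rule B) (simp_all add: y \<gamma>.scaleR T.scaleR blinfun.scaleR_right)
    then show False using \<open>y \<noteq> 0\<close> by simp
  qed
  have ker_trivial: "y = 0" if "\<gamma> y = 0" "T y = 0" for y
    using ker_nonneg[of y] ker_nonneg[of "- y"] that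
    by (cases "0 \<le> blinfun_apply f y") (auto simp: \<gamma>.neg T.neg blinfun.minus_right)
  assume "\<not> bounded {x. E x + (norm (\<gamma> x))\<^sup>2 - blinfun_apply f x \<le> C}"
  then have "\<exists>x. E x + (norm (\<gamma> x))\<^sup>2 - blinfun_apply f x \<le> C \<and> real n < norm x" for n
    by (auto simp: bounded_iff not_le)
  then obtain xs where xs: "\<And>n. E (xs n) + (norm (\<gamma> (xs n)))\<^sup>2 - blinfun_apply f (xs n) \<le> C"
      "\<And>n. real n < norm (xs n)" by metis
  define s where "s n = norm (xs n)" for n
  define ys where "ys n = (1 / s n) *\<^sub>R xs n" for n
  define K where "K = norm f"
  have s_pos: "0 < s n" for n unfolding s_def by (rule le_less_trans[OF of_nat_0_le_iff xs(2)])
  have f_le: "blinfun_apply f (xs n) \<le> K * s n" for n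
    using norm_blinfun[of f "xs n"] by (simp add: K_def s_def)
  have s_top: "filterlim s at_top sequentially"
    using xs(2) by (intro filterlim_at_top_mono[OF filterlim_real_sequentially]) (auto simp: s_def less_imp_le)
  have norm_ys: "norm (ys n) = 1" for n using s_pos[of n] by (simp add: ys_def s_def)
  have \<gamma>_ys: "(\<lambda>n. norm (\<gamma> (ys n))) \<longlonglongrightarrow> 0"
  proof -
    have "((\<lambda>t. (C - e0 + K * t) / t\<^sup>2) \<longlongrightarrow> 0) at_top" by real_asymp
    from filterlim_compose[OF this s_top] have "(\<lambda>n. (C - e0 + K * s n) / (s n)\<^sup>2) \<longlonglongrightarrow> 0" .
    then have "(\<lambda>n. (norm (\<gamma> (ys n)))\<^sup>2) \<longlonglongrightarrow> 0"
    proof (rule Lim_null_comparison[rotated], intro always_eventually allI)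
      fix n
      have "(norm (\<gamma> (ys n)))\<^sup>2 = (norm (\<gamma> (xs n)))\<^sup>2 / (s n)\<^sup>2"
        using s_pos[of n] by (simp add: ys_def \<gamma>.scaleR power_divide)
      also have "\<dots> \<le> (C - e0 + K * s n) / (s n)\<^sup>2"
        using xs(1)[of n] f_le[of n] E[of "xs n"] by (intro divide_right_mono) auto
      finally show "norm ((norm (\<gamma> (ys n)))\<^sup>2) \<le> (C - e0 + K * s n) / (s n)\<^sup>2" by simp
    qed
    then show ?thesis using tendsto_null_power by force
  qed
  have T_ys: "(\<lambda>n. norm (T (ys n))) \<longlonglongrightarrow> 0"
  proof -
    \<comment> \<open>Since \<open>E\<close> is at least \<open>e0\<close>, passing to
      \<open>\<bar>E\<bar>\<close> costs at most \<open>2 * \<bar>e0\<bar>\<close>;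
      \<open>c\<^sub>2\<close> is the offset of the growth condition.\<close>
    define b where "b = C + 2 * \<bar>e0\<bar> + c\<^sub>2"
    have "((\<lambda>t. (b + K * t) / c\<^sub>1 / t powr p) \<longlongrightarrow> 0) at_top"
      using growth(1,2) by real_asymp
    from filterlim_compose[OF this s_top] have "(\<lambda>n. (b + K * s n) / c\<^sub>1 / s n powr p) \<longlonglongrightarrow> 0" .
    then have "(\<lambda>n. norm (T (ys n)) powr p) \<longlonglongrightarrow> 0"
    proof (rule Lim_null_comparison[rotated], intro always_eventually allI)
      fix n
      have "c\<^sub>1 * norm (T (xs n)) powr p \<le> b + K * s n"
      proof -
        have "E (xs n) - blinfun_apply f (xs n) \<le> C"
          using xs(1)[of n] zero_le_power2[of "norm (\<gamma> (xs n))"] by linarith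
        moreover have "\<bar>E (xs n)\<bar> \<le> E (xs n) + 2 * \<bar>e0\<bar>" using E[of "xs n"] by linarith
        ultimately show ?thesis using growth(3)[of "xs n"] f_le[of n] unfolding b_def by linarith
      qed
      then have "norm (T (xs n)) powr p \<le> (b + K * s n) / c\<^sub>1"
        using growth(2) by (simp add: field_simps)
      then have "norm (T (xs n)) powr p / s n powr p \<le> (b + K * s n) / c\<^sub>1 / s n powr p"
        by (rule divide_right_mono) simp
      moreover have "norm (T (ys n)) powr p = norm (T (xs n)) powr p / s n powr p"
        using s_pos[of n] by (simp add: ys_def T.scaleR powr_divide)
      ultimately show "norm (norm (T (ys n)) powr p) \<le> (b + K * s n) / c\<^sub>1 / s n powr p"
        by simp
    qed
    then have "(\<lambda>n. (norm (T (ys n)) powr p) powr (1 / p)) \<longlonglongrightarrow> 0"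
      using growth(1) by (intro tendsto_zero_powrI[OF _ tendsto_const[of "1 / p"]]) auto
    then show ?thesis using growth(1) by (simp add: powr_powr)
  qed
  have "bounded (range ys)" by (auto simp: bounded_iff norm_ys)
  then obtain r y where r: "strict_mono r" "weak_lim (\<lambda>n. ys (r n)) y"
    using weakly_convergent_subsequence[OF refl] by blast
  have sub: "(\<lambda>n. h (ys (r n))) \<longlonglongrightarrow> 0" if "(\<lambda>n. h (ys n)) \<longlonglongrightarrow> 0" for h :: "'x \<Rightarrow> real"
    using LIMSEQ_subseq_LIMSEQ[OF that r(1)] by (simp add: o_def)
  have Ty: "T y = 0" by (rule weak_lim_kernel[OF T r(2) sub[OF T_ys]])
  have "\<gamma> y = 0" by (rule weak_lim_kernel[OF \<gamma> r(2) sub[OF \<gamma>_ys]])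
  then have "y = 0" using ker_trivial Ty by blast
  \<comment> \<open>With weak limit \<open>0\<close>, compactness gives
    \<open>snorm (ys (r n))\<close> tending to \<open>0\<close>. Both summands of the norm vanish in
    the limit, although every \<open>ys n\<close> has norm \<open>1\<close>.\<close>
  then have "(\<lambda>n. snorm (ys (r n)) + norm (T (ys (r n)))) \<longlonglongrightarrow> 0"
    using tendsto_add[OF compact[OF r(2)] sub[OF T_ys]] by simp
  then have "(\<lambda>n. norm (ys (r n))) \<longlonglongrightarrow> 0" unfolding norm .
  then show False by (simp add: norm_ys LIMSEQ_const_iff)
qed

section \<open>Approximation by increasing sets\<close>

lemma net_elements_mono: "m \<le> n \<Longrightarrow> net_elements cls \<rho> m \<subseteq> net_elements cls \<rho> n"
  unfolding net_elements_def net_functions_def networks_def using order_trans by fast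

text \<open>Density alone leaves the index of the approximating set free, whereas a recovery
  sequence must have its \<open>n\<close>-th term in the \<open>n\<close>-th set. Near-best
  approximations from each \<open>S n\<close> work, since monotonicity keeps every good point
  available later.\<close>

lemma closure_UN_increasing_limit:
  fixes x :: "'a::metric_space"
  assumes mono: "\<And>m n. m \<le> n \<Longrightarrow> S m \<subseteq> S n" and x: "x \<in> closure (\<Union>n::nat. S n)"
  obtains xs where "xs \<longlonglongrightarrow> x" "\<forall>\<^sub>F n in sequentially. xs n \<in> S n"
proof -
  \<comment> \<open>Early sets may be empty, hence the conditional choice and the eventual
    membership in the conclusion.\<close>
  have "\<exists>y. S n \<noteq> {} \<longrightarrow> y \<in> S n \<and> dist x y < infdist x (S n) + 1 / real (Suc n)" for n
  proof (cases "S n = {}")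
    case False
    have "bdd_below (dist x ` S n)" by (rule bdd_belowI2[of _ 0]) simp
    then have "\<exists>y\<in>S n. dist x y < infdist x (S n) + 1 / real (Suc n)"
      using cINF_less_iff[OF False, of "dist x" "infdist x (S n) + 1 / real (Suc n)"]
      by (simp add: infdist_notempty[OF False])
    then show ?thesis by blast
  qed simp
  then obtain xs where xs: "\<And>n. S n \<noteq> {} \<Longrightarrow> xs n \<in> S n \<and> dist x (xs n) < infdist x (S n) + 1 / real (Suc n)"
    by metis
  have near: "\<exists>m y. y \<in> S m \<and> dist x y < e" if "0 < e" for e
    using closure_approachableD[OF x that] by blast
  have "xs \<longlonglongrightarrow> x"
  proof (rule metric_LIMSEQ_I)
    fix e :: real assume e: "0 < e"
    then obtain m y where y: "y \<in> S m" "dist x y < e/2" using near[of "e/2"] by auto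
    obtain k where k: "1 / real (Suc k) < e/2" using nat_approx_posE[of "e/2"] e by auto
    have "dist (xs n) x < e" if n: "max m k \<le> n" for n
    proof -
      have yn: "y \<in> S n" using y(1) mono[of m n] n by auto
      have "1 / real (Suc n) \<le> 1 / real (Suc k)" using n by (intro divide_left_mono) auto
      moreover have "dist x (xs n) < infdist x (S n) + 1 / real (Suc n)" using xs yn by blast
      ultimately show ?thesis using infdist_le[OF yn, of x] y(2) k by (simp add: dist_commute)
    qed
    then show "\<exists>N. \<forall>n\<ge>N. dist (xs n) x < e" by blast
  qed
  moreover have "\<forall>\<^sub>F n in sequentially. xs n \<in> S n"
  proof -
    obtain m y where "y \<in> S m" using near[of 1] by auto
    then have "xs n \<in> S n" if "m \<le> n" for n using mono[OF that] xs by blast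
    then show ?thesis by (auto simp: eventually_sequentially)
  qed
  ultimately show ?thesis by (rule that)
qed

section \<open>Gamma-convergence and quasi-minimisers\<close>

theorem theorem19:
  fixes \<rho> :: "real \<Rightarrow> real"
    and \<Omega> :: "(real ^ 'd) set"
    and cls :: "'x::banach \<Rightarrow> (real ^ 'd \<Rightarrow> real) set"
    and T :: "'x \<Rightarrow> 'y::banach"
    and \<gamma> :: "'x \<Rightarrow> 'b::banach"
    and E :: "'x \<Rightarrow> real"
    and snorm :: "'x \<Rightarrow> real"
    and f :: "'x \<Rightarrow>\<^sub>L real"
    and A :: "nat \<Rightarrow> 'x set" and X\<^sub>0 :: "'x set"
    and Fn :: "nat \<Rightarrow> 'x \<Rightarrow> ereal" and F :: "'x \<Rightarrow> ereal"
  defines "A \<equiv> net_elements cls \<rho>"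
    and "X\<^sub>0 \<equiv> {x. \<gamma> x = 0}"
    and "Fn \<equiv> penalised_energy A E \<gamma> (blinfun_apply f)"
    and "F \<equiv> limit_energy X\<^sub>0 E (blinfun_apply f)"
  assumes domain: "open \<Omega>" "connected \<Omega>" "\<Omega> \<noteq> {}"
    and X_functions: "function_space \<Omega> cls"
    and networks_in_X: "\<And>n. net_functions \<rho> n \<subseteq> (\<Union>x. cls x)"
    and snorm: "is_norm snorm"
    and H1: "X\<^sub>0 \<subseteq> closure ((\<Union>n. A n) \<inter> X\<^sub>0)"
    and H2: "reflexive_space TYPE('x)" "bounded_linear T"
            "\<And>x. norm x = snorm x + norm (T x)"
    and H3: "\<And>xs x. weak_lim xs x \<Longrightarrow> (\<lambda>n. snorm (xs n - x)) \<longlonglongrightarrow> 0"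
    and H4: "bounded_linear \<gamma>"
            "\<And>r. bounded ({x. (norm (\<gamma> x))\<^sup>2 - blinfun_apply f x \<le> r} \<inter> {x. T x = 0})"
    and H5: "bdd_below (range E)" "weakly_lsc E" "continuous_on UNIV E"
            "\<exists>p c\<^sub>1 c\<^sub>2. p > 1 \<and> c\<^sub>1 > 0 \<and> (\<forall>x. \<bar>E x\<bar> \<ge> c\<^sub>1 * norm (T x) powr p - c\<^sub>2)"
            "\<exists>!z. is_arg_min E (\<lambda>x. x \<in> X\<^sub>0) z"
  shows "weak_Gamma_converges Fn F \<and>
         (\<exists>z. is_arg_min F (\<lambda>_. True) z) \<and>
         (\<forall>z. is_arg_min F (\<lambda>_. True) z \<and> (\<forall>y. is_arg_min F (\<lambda>_. True) y \<longrightarrow> y = z) \<longrightarrow>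
              (\<forall>xs. quasi_minimisers Fn xs \<longrightarrow> weak_lim xs z))"
proof -
  interpret \<gamma>: bounded_linear \<gamma> by (rule H4(1))
  let ?f = "blinfun_apply f"
  have A_mono: "A m \<subseteq> A n" if "m \<le> n" for m n
    unfolding A_def using that by (rule net_elements_mono)
  have Fn: "Fn n x = (if x \<in> A n then ereal (E x + real n * (norm (\<gamma> x))\<^sup>2 - ?f x) else \<infinity>)" for n x
    by (simp add: Fn_def penalised_energy_def)
  have F: "F x = (if \<gamma> x = 0 then ereal (E x - ?f x) else \<infinity>)" for x
    by (simp add: F_def limit_energy_def X\<^sub>0_def)
  obtain e0 where e0: "\<And>x. e0 \<le> E x" using H5(1) by (auto simp: bdd_below_def)
  obtain p c\<^sub>1 c\<^sub>2 where growth: "p > 1" "c\<^sub>1 > 0" "\<And>x. \<bar>E x\<bar> \<ge> c\<^sub>1 * norm (T x) powr p - c\<^sub>2"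
    using H5(4) by blast
  \<comment> \<open>Weight \<open>1\<close> serves all cases: this energy lies below
    \<open>Fn n\<close> for \<open>n \<ge> 1\<close> and below \<open>F\<close>.\<close>
  have coercive: "bounded {x. E x + (norm (\<gamma> x))\<^sup>2 - ?f x \<le> C}" for C
    by (rule energy_coercive[OF H2(1) H2(2) H2(3) H3 H4(1) H4(2)[of 0] e0 growth])
  \<comment> \<open>The majorant \<open>h\<close> lets the same estimate apply to \<open>Fn\<close>
    itself, to \<open>F\<close> along a minimising sequence, and to upper bounds along
    subsequences.\<close>
  have F_le: "F x \<le> liminf h"
    if "weak_lim ys x" "filterlim N at_top sequentially"
      "\<forall>\<^sub>F n in sequentially. ereal (E (ys n) + N n * (norm (\<gamma> (ys n)))\<^sup>2 - ?f (ys n)) \<le> h n"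
    for ys x h and N :: "nat \<Rightarrow> real"
    using order_trans[OF penalised_liminf[OF H5(2) e0 H4(1) that(1,2), of f] Liminf_mono[OF that(3)]]
    by (simp add: F_def X\<^sub>0_def)
  have F_minimal: "is_arg_min F (\<lambda>_. True) x \<longleftrightarrow> (\<forall>y. F x \<le> F y)" for x
    by (simp add: is_arg_min_linorder)
  have weak_subseq: "\<exists>r x. strict_mono (r::nat\<Rightarrow>nat) \<and> weak_lim (\<lambda>n. ys (r n)) x"
    if "\<forall>\<^sub>F n in sequentially. E (ys n) + (norm (\<gamma> (ys n)))\<^sup>2 - ?f (ys n) \<le> C" for ys C
  proof -
    obtain K where K: "\<And>x. E x + (norm (\<gamma> x))\<^sup>2 - ?f x \<le> C \<Longrightarrow> norm x \<le> K"
      using coercive[of C] by (auto simp: bounded_iff)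
    have "\<forall>\<^sub>F n in sequentially. norm (ys n) \<le> K" using that by (rule eventually_mono) (rule K)
    then have "bounded (range ys)" using BfunI Bseq_eq_bounded by blast
    then show ?thesis using weakly_convergent_subsequence[OF H2(1)] by metis
  qed
  have F0: "F 0 = ereal (E 0)" by (simp add: F \<gamma>.zero blinfun.zero_right)

  have liminf_ineq: "F x \<le> liminf (\<lambda>n. Fn n (xs n))" if "weak_lim xs x" for x xs
    by (rule F_le[OF that filterlim_real_sequentially]) (simp add: Fn)
  have recovery: "\<exists>xs. weak_lim xs x \<and> (\<lambda>n. Fn n (xs n)) \<longlonglongrightarrow> F x" for x
  proof (cases "\<gamma> x = 0")
    case True
    then have "x \<in> closure (\<Union>n. A n \<inter> X\<^sub>0)" using H1 by (auto simp: X\<^sub>0_def)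
    then obtain xs where xs: "xs \<longlonglongrightarrow> x" "\<forall>\<^sub>F n in sequentially. xs n \<in> A n \<inter> X\<^sub>0"
      using closure_UN_increasing_limit[of "\<lambda>n. A n \<inter> X\<^sub>0" x] A_mono by blast
    have "(\<lambda>n. E (xs n) - ?f (xs n)) \<longlonglongrightarrow> E x - ?f x"
      using xs(1) by (intro tendsto_diff continuous_on_tendsto_compose[OF H5(3)] blinfun.tendsto) auto
    then have "(\<lambda>n. ereal (E (xs n) - ?f (xs n))) \<longlonglongrightarrow> F x" by (simp add: F True)
    \<comment> \<open>The approximants lie in \<open>X\<^sub>0\<close>, so their penalty is zero at
      every weight.\<close>
    moreover have "\<forall>\<^sub>F n in sequentially. ereal (E (xs n) - ?f (xs n)) = Fn n (xs n)"
      using xs(2) by (rule eventually_mono) (auto simp: Fn X\<^sub>0_def)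
    ultimately have "(\<lambda>n. Fn n (xs n)) \<longlonglongrightarrow> F x" by (rule Lim_transform_eventually)
    then show ?thesis using weak_lim_strong[OF xs(1)] by blast
  next
    case False
    have F_x: "F x = \<infinity>" using False by (simp add: F)
    have const: "weak_lim (\<lambda>_. x) x" by (rule weak_lim_strong) (rule tendsto_const)
    \<comment> \<open>Off \<open>X\<^sub>0\<close> the constant sequence is a recovery sequence: the
      lower bound alone forces its energies to infinity.\<close>
    have "liminf (\<lambda>n. Fn n x) = \<infinity>" using liminf_ineq[OF const] unfolding F_x by simp
    then have "(\<lambda>n. Fn n x) \<longlonglongrightarrow> F x"
      unfolding F_x by (rule Liminf_PInfty[THEN iffD2, rotated]) simp
    with const show ?thesis by blast
  qed

  have minimiser: "\<exists>z. is_arg_min F (\<lambda>_. True) z"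
  proof -
    \<comment> \<open>This is the direct method. Comparison with \<open>F 0\<close> makes a
      minimising sequence eventually finite, hence in the kernel of \<open>\<gamma>\<close> and
      within a coercive sublevel set.\<close>
    obtain u where u: "\<And>n. u n \<in> range F" "u \<longlonglongrightarrow> Inf (range F)"
      using Inf_as_limit[of "range F"] by auto
    then have "\<forall>n. \<exists>y. u n = F y" by blast
    then obtain ys where ys: "\<And>n. u n = F (ys n)" by metis
    have "Inf (range F) \<le> F 0" by (rule Inf_lower) simp
    then have "Inf (range F) < ereal (E 0 + 1)" by (rule order.strict_trans1) (simp add: F0)
    then have small: "\<forall>\<^sub>F n in sequentially. F (ys n) < ereal (E 0 + 1)"
      using order_tendstoD(2)[OF u(2)] by (simp add: ys)
    have "\<forall>\<^sub>F n in sequentially. E (ys n) + (norm (\<gamma> (ys n)))\<^sup>2 - ?f (ys n) \<le> E 0 + 1"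
      using small by (rule eventually_mono) (simp add: F split: if_splits)
    from weak_subseq[OF this] obtain r x where r: "strict_mono (r::nat\<Rightarrow>nat)" "weak_lim (\<lambda>n. ys (r n)) x"
      by blast
    have "F x \<le> liminf (\<lambda>n. F (ys (r n)))"
      by (rule F_le[OF r(2) filterlim_real_sequentially]) (simp add: F)
    also have "\<dots> = Inf (range F)"
      using LIMSEQ_subseq_LIMSEQ[OF u(2) r(1)] by (intro lim_imp_Liminf) (simp_all add: o_def ys)
    finally have "F x \<le> F y" for y by (rule order_trans) (simp add: Inf_lower)
    then show ?thesis by (intro exI[of _ x]) (simp add: F_minimal)
  qed
  have quasi: "weak_lim xs z"
    if z: "is_arg_min F (\<lambda>_. True) z" "\<And>y. is_arg_min F (\<lambda>_. True) y \<Longrightarrow> y = z"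
      and xs: "quasi_minimisers Fn xs" for z xs
  proof -
    obtain \<delta> where \<delta>: "\<delta> \<longlonglongrightarrow> 0" "\<And>n. Fn n (xs n) \<le> (INF x. Fn n x) + ereal (\<delta> n)"
      using xs by (auto simp: quasi_minimisers_def)
    have "F z \<le> F 0" using z(1) by (simp add: F_minimal)
    \<comment> \<open>Finiteness of the minimum is needed for adding limits in the extended reals
      and for a real sublevel bound.\<close>
    then obtain a where a: "F z = ereal a" by (auto simp: F F0 split: if_splits)
    obtain zs where zs: "(\<lambda>n. Fn n (zs n)) \<longlonglongrightarrow> F z" using recovery by blast
    \<comment> \<open>The infimum of \<open>Fn n\<close> is at most its value on a recovery sequence
      for \<open>z\<close>, so \<open>u\<close> bounds the quasi-minimal energies and tends to
      \<open>F z\<close>.\<close>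
    define u where "u n = Fn n (zs n) + ereal (\<delta> n)" for n
    have u: "u \<longlonglongrightarrow> F z"
      using tendsto_add_ereal[OF _ _ zs, of 0 "\<lambda>n. ereal (\<delta> n)"] \<delta>(1)
      by (simp add: u_def[abs_def] a zero_ereal_def)
    have Fn_u: "Fn n (xs n) \<le> u n" for n
      unfolding u_def
      by (rule order_trans[OF \<delta>(2) add_right_mono[OF INF_lower[OF UNIV_I]]])
    have "\<forall>\<^sub>F n in sequentially. u n < ereal (a + 1)"
      using order_tendstoD(2)[OF u, of "ereal (a + 1)"] by (simp add: a)
    then have bound: "\<forall>\<^sub>F n in sequentially. E (xs n) + (norm (\<gamma> (xs n)))\<^sup>2 - ?f (xs n) \<le> a + 1"
      \<comment> \<open>At \<open>n = 0\<close> there is no penalty; from \<open>n = 1\<close> on it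
        dominates the unit penalty of the coercivity estimate.\<close>
      using eventually_ge_at_top[of "1::nat"]
    proof eventually_elim
      case (elim n)
      have "Fn n (xs n) < ereal (a + 1)" using elim(1) by (rule order.strict_trans1[OF Fn_u])
      then have "E (xs n) + real n * (norm (\<gamma> (xs n)))\<^sup>2 - ?f (xs n) < a + 1"
        by (auto simp: Fn split: if_splits)
      moreover have "1 * (norm (\<gamma> (xs n)))\<^sup>2 \<le> real n * (norm (\<gamma> (xs n)))\<^sup>2"
        using elim by (intro mult_right_mono) auto
      ultimately show ?case by linarith
    qed
    have "(\<lambda>n. blinfun_apply g (xs n)) \<longlonglongrightarrow> blinfun_apply g z" for g :: "'x \<Rightarrow>\<^sub>L real"
    proof (rule subseq_tendstoI)
      fix r :: "nat \<Rightarrow> nat" assume r: "strict_mono r"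
      \<comment> \<open>Each subsequence has a weakly convergent further subsequence. Its limit has
        energy at most \<open>F z\<close>, so uniqueness identifies it with
        \<open>z\<close>.\<close>
      obtain s x where s: "strict_mono (s::nat\<Rightarrow>nat)" "weak_lim (\<lambda>n. xs (r (s n))) x"
        using weak_subseq[OF eventually_subseq[OF r bound]] by blast
      have rs: "strict_mono (\<lambda>n. r (s n))" using strict_mono_o[OF r s(1)] by (simp add: o_def)
      have "F x \<le> liminf (\<lambda>n. u (r (s n)))"
      proof (rule F_le[OF s(2)])
        \<comment> \<open>Along the subsequence the weights are the original indices
          \<open>r (s n)\<close>.\<close>
        show "filterlim (\<lambda>n. real (r (s n))) at_top sequentially"
          by (rule filterlim_compose[OF filterlim_real_sequentially filterlim_subseq[OF rs]])
        have Fn_ge: "ereal (E x + real n * (norm (\<gamma> x))\<^sup>2 - ?f x) \<le> Fn n x" for n x by (simp add: Fn)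
        show "\<forall>\<^sub>F n in sequentially. ereal (E (xs (r (s n))) + real (r (s n)) * (norm (\<gamma> (xs (r (s n)))))\<^sup>2
            - ?f (xs (r (s n)))) \<le> u (r (s n))"
          by (intro always_eventually allI order_trans[OF Fn_ge Fn_u])
      qed
      also have "\<dots> = F z"
        using LIMSEQ_subseq_LIMSEQ[OF u rs] by (intro lim_imp_Liminf) (simp_all add: o_def)
      finally have "F x \<le> F z" .
      then have "F x \<le> F y" for y using z(1) order_trans[of "F x" "F z" "F y"] by (simp add: F_minimal)
      then have "x = z" using z(2) by (simp add: F_minimal)
      then show "\<exists>s. strict_mono s \<and> (\<lambda>n. blinfun_apply g (xs (r (s n)))) \<longlonglongrightarrow> blinfun_apply g z"
        using s by (intro exI[of _ s]) (simp add: weak_lim_iff)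
    qed
    then show ?thesis by (simp add: weak_lim_iff)
  qed
  have "weak_Gamma_converges Fn F"
    using liminf_ineq recovery by (simp add: weak_Gamma_converges_def)
  with minimiser show ?thesis by (intro conjI allI impI quasi) auto
qed

end
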